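(* Let $K\ge1$, $L,R>0$, and let $\alpha_0=1,\alpha_1,\dots,\alpha_K\ge0$, $A_k=\sum_{i=0}^k\alpha_i$. Assume $A_k-\alpha_k^2>0$ for $k=1,\dots,K$ and $b_i>0$ for $i=0,\dots,K-1$. Consider the problem (D) defined in the context, restricted by fixing $v_{i,i+1}=A_i/A_K$, $i=0,\dots,K-1$, while optimizing over $\tau\ge0$ and $\mathbf{u}\ge\mathbf{0}$. The equality constraint in (D) then uniquely determines $$v_{*,0}=v_{0,1},\qquad v_{*,i}=v_{i,i+1}-v_{i-1,i},\ i=1,\dots,K-1,\qquad v_{*,K}=1-v_{K-1,K}.$$ Then the optimal solution of this restricted problem is $$\tau^*=\frac{L}{4A_K},\qquad u_i^*=\hat u_i:=\frac{(\mathbf{H}\mathbf{b})_i}{b_i},\quad i=0,\dots,K-1,$$ where $\mathbf{b}=(b_0,\dots,b_{K-1})^\top$ and $\mathbf{H}$ is defined in the context, and it (together with $\mathbf{v}=(v_{i,i+1})_{i=0}^{K-1}$ given by $v_{i,i+1}=A_i/A_K$ for $i=0,\dots,K-1$, and $\mathbf{v}_*=(v_{*,i})_{i=0}^{K}$ given by $v_{*,0}=v_{0,1}$, $v_{*,i}=v_{i,i+1}-v_{i-1,i}$ for $i=1,\dots,K-1$, $v_{*,K}=1-v_{K-1,K}$) is also a feasible solution of (D). Moreover, the optimal objective value of the restricted problem is $$\frac{LR^2}{4A_K}+\mathbf{b}^\top\mathbf{H}\mathbf{b}.$$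
   Context: Algorithm coefficients: for $1\le k\le K$, $$\theta_{k,k-1}=\frac{2\alpha_{k-1}\alpha_k+A_{k-1}}{A_k},\qquad \theta_{k,i}=\frac{2\alpha_k\alpha_i}{A_k}+\frac{A_{k-1}}{A_k}\theta_{k-1,i}\quad(0\le i\le k-2).$$ Selector vectors: $\vec{\mathbf{f}}_0,\dots,\vec{\mathbf{f}}_K$ is the standard basis of $\mathbb{R}^{K+1}$ and $\vec{\mathbf{f}}_*=\mathbf{0}$. In $\mathbb{R}^{2K+2}$, the vectors $\vec{\mathbf{x}}_0,\vec{\mathbf{e}}_0,\dots,\vec{\mathbf{e}}_{K-1},\vec{\mathbf{g}}_0,\dots,\vec{\mathbf{g}}_K$ are, in this order, the standard basis vectors; $\vec{\mathbf{x}}_*=\vec{\mathbf{g}}_*=\mathbf{0}$; and $\vec{\mathbf{x}}_k=\vec{\mathbf{x}}_0-\frac1L\sum_{i=0}^{k-1}\theta_{k,i}(\vec{\mathbf{g}}_i+\vec{\mathbf{e}}_i)$ for $k=1,\dots,K$. For $i,j\in\{*,0,\dots,K\}$, $$\mathbf{A}^{i,j}=\tfrac12\left((\vec{\mathbf{x}}_i-\vec{\mathbf{x}}_j)\vec{\mathbf{g}}_j^\top+\vec{\mathbf{g}}_j(\vec{\mathbf{x}}_i-\vec{\mathbf{x}}_j)^\top\right)+\tfrac1{2L}(\vec{\mathbf{g}}_i-\vec{\mathbf{g}}_j)(\vec{\mathbf{g}}_i-\vec{\mathbf{g}}_j)^\top.$$ Problem (D): over $\tau\ge0$, $\mathbf{v}=(v_{i,i+1})_{i=0}^{K-1}\ge\mathbf{0}$,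 $\mathbf{v}_*=(v_{*,i})_{i=0}^K\ge\mathbf{0}$, $\mathbf{u}=(u_i)_{i=0}^{K-1}\ge\mathbf{0}$, $$\min\ \tau R^2+\sum_{i=0}^{K-1}u_ib_i^2$$ subject to $$\vec{\mathbf{f}}_K+\sum_{i=0}^{K-1}v_{i,i+1}(\vec{\mathbf{f}}_i-\vec{\mathbf{f}}_{i+1})+\sum_{i=0}^Kv_{*,i}(\vec{\mathbf{f}}_*-\vec{\mathbf{f}}_i)=\mathbf{0},$$ $$\sum_{i=0}^{K-1}v_{i,i+1}\mathbf{A}^{i,i+1}+\sum_{i=0}^Kv_{*,i}\mathbf{A}^{*,i}+\tau\vec{\mathbf{x}}_0\vec{\mathbf{x}}_0^\top+\sum_{i=0}^{K-1}u_i\vec{\mathbf{e}}_i\vec{\mathbf{e}}_i^\top+\frac1{2L}\vec{\mathbf{g}}_K\vec{\mathbf{g}}_K^\top\succeq0.$$ Matrix $\mathbf{H}$: $\mathbf{H}=\bar{\mathbf{B}}\mathbf{D}^{-1}\bar{\mathbf{B}}^\top\in\mathbb{R}^{K\times K}$, where $\mathbf{D}=\mathrm{diag}\left(\frac{A_1-\alpha_1^2}{LA_K},\dots,\frac{A_K-\alpha_K^2}{LA_K}\right)$ and $\bar{\mathbf{B}}$ has rows indexed by $i=0,\dots,K-1$, columns indexed by $j=1,\dots,K$, with entries $\bar B_{i,j}=\frac{2\alpha_{i}\alpha_{i+1}+A_{i}}{2LA_K}$ if $j=i+1$, $\bar B_{i,j}=\frac{\alpha_i\alpha_j}{LA_K}$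 if $j\ge i+2$, and $0$ if $j\le i$. Rows and columns of $\mathbf{H}$ are indexed by $0,\dots,K-1$. *)

theory Defs
  imports Complex_Main "Jordan_Normal_Form.Gauss_Jordan_Elimination"
begin

definition psd :: "nat \<Rightarrow> real mat \<Rightarrow> bool" where
  "psd n M \<longleftrightarrow> M \<in> carrier_mat n n \<and> transpose_mat M = M
     \<and> (\<forall>x \<in> carrier_vec n. 0 \<le> x \<bullet> (M *\<^sub>v x))"

(* u v^T *)
definition outer :: "real vec \<Rightarrow> real vec \<Rightarrow> real mat" where
  "outer u v = mat (dim_vec u) (dim_vec v) (\<lambda>(i, j). u $ i * v $ j)"

abbreviation vsum :: "nat \<Rightarrow> (nat \<Rightarrow> real vec) \<Rightarrow> nat set \<Rightarrow> real vec" where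
  "vsum n f S \<equiv> finsum_vec TYPE(real) n f S"

abbreviation msum :: "nat \<Rightarrow> (nat \<Rightarrow> real mat) \<Rightarrow> nat set \<Rightarrow> real mat" where
  "msum n f S \<equiv> finsum (ring_mat TYPE(real) n ()) f S"

definition partial_sum :: "(nat \<Rightarrow> real) \<Rightarrow> nat \<Rightarrow> real" where
  "partial_sum \<alpha> k = (\<Sum>i\<le>k. \<alpha> i)"

(* theta alpha k i is only meaningful for i < k, and is 0 otherwise *)
primrec theta :: "(nat \<Rightarrow> real) \<Rightarrow> nat \<Rightarrow> nat \<Rightarrow> real" where
  "theta \<alpha> 0 i = 0"
| "theta \<alpha> (Suc k) i =
     (if i = k then (2 * \<alpha> k * \<alpha> (Suc k) + partial_sum \<alpha> k) / partial_sum \<alpha> (Suc k)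
      else if i < k then
        2 * \<alpha> (Suc k) * \<alpha> i / partial_sum \<alpha> (Suc k)
        + partial_sum \<alpha> k / partial_sum \<alpha> (Suc k) * theta \<alpha> k i
      else 0)"

datatype point = Star | Iter nat

fun f_vec :: "nat \<Rightarrow> point \<Rightarrow> real vec" where
  "f_vec K Star = 0\<^sub>v (K + 1)"
| "f_vec K (Iter i) = unit_vec (K + 1) i"

(* Coordinates of R^(2K+2): 0 is x_0, then 1, ..., K are e_0, ..., e_(K-1),
   then K+1, ..., 2K+1 are g_0, ..., g_K. *)
definition e_vec :: "nat \<Rightarrow> nat \<Rightarrow> real vec" where
  "e_vec K i = unit_vec (2 * K + 2) (1 + i)"

fun g_vec :: "nat \<Rightarrow> point \<Rightarrow> real vec" where
  "g_vec K Star = 0\<^sub>v (2 * K + 2)"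
| "g_vec K (Iter i) = unit_vec (2 * K + 2) (1 + K + i)"

(* For k = 0 the sum is empty, so that x_0 is the first standard basis vector. *)
fun x_vec :: "nat \<Rightarrow> real \<Rightarrow> (nat \<Rightarrow> real) \<Rightarrow> point \<Rightarrow> real vec" where
  "x_vec K L \<alpha> Star = 0\<^sub>v (2 * K + 2)"
| "x_vec K L \<alpha> (Iter k) = unit_vec (2 * K + 2) 0
     - (1 / L) \<cdot>\<^sub>v vsum (2 * K + 2) (\<lambda>i. theta \<alpha> k i \<cdot>\<^sub>v (g_vec K (Iter i) + e_vec K i)) {..<k}"

definition A_mat :: "nat \<Rightarrow> real \<Rightarrow> (nat \<Rightarrow> real) \<Rightarrow> point \<Rightarrow> point \<Rightarrow> real mat" where
  "A_mat K L \<alpha> i j =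
     (1 / 2) \<cdot>\<^sub>m (outer (x_vec K L \<alpha> i - x_vec K L \<alpha> j) (g_vec K j)
               + outer (g_vec K j) (x_vec K L \<alpha> i - x_vec K L \<alpha> j))
     + (1 / (2 * L)) \<cdot>\<^sub>m outer (g_vec K i - g_vec K j) (g_vec K i - g_vec K j)"

(* The multipliers are vectors: v $ i = v_(i,i+1) and u $ i = u_i for i < K,
   and vs $ i = v_{*,i} for i <= K. *)
definition D_equality :: "nat \<Rightarrow> real vec \<Rightarrow> real vec \<Rightarrow> bool" where
  "D_equality K v vs \<longleftrightarrow>
     f_vec K (Iter K)
     + vsum (K + 1) (\<lambda>i. v $ i \<cdot>\<^sub>v (f_vec K (Iter i) - f_vec K (Iter (i + 1)))) {..<K}
     + vsum (K + 1) (\<lambda>i. vs $ i \<cdot>\<^sub>v (f_vec K Star - f_vec K (Iter i))) {..K}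
     = 0\<^sub>v (K + 1)"

definition D_matrix ::
  "nat \<Rightarrow> real \<Rightarrow> (nat \<Rightarrow> real) \<Rightarrow> real \<Rightarrow> real vec \<Rightarrow> real vec \<Rightarrow> real vec \<Rightarrow> real mat" where
  "D_matrix K L \<alpha> \<tau> v vs u =
     msum (2 * K + 2) (\<lambda>i. v $ i \<cdot>\<^sub>m A_mat K L \<alpha> (Iter i) (Iter (i + 1))) {..<K}
     + msum (2 * K + 2) (\<lambda>i. vs $ i \<cdot>\<^sub>m A_mat K L \<alpha> Star (Iter i)) {..K}
     + \<tau> \<cdot>\<^sub>m outer (x_vec K L \<alpha> (Iter 0)) (x_vec K L \<alpha> (Iter 0))
     + msum (2 * K + 2) (\<lambda>i. u $ i \<cdot>\<^sub>m outer (e_vec K i) (e_vec K i)) {..<K}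
     + (1 / (2 * L)) \<cdot>\<^sub>m outer (g_vec K (Iter K)) (g_vec K (Iter K))"

definition D_feasible ::
  "nat \<Rightarrow> real \<Rightarrow> (nat \<Rightarrow> real) \<Rightarrow> real \<Rightarrow> real vec \<Rightarrow> real vec \<Rightarrow> real vec \<Rightarrow> bool" where
  "D_feasible K L \<alpha> \<tau> v vs u \<longleftrightarrow>
     0 \<le> \<tau>
     \<and> v \<in> carrier_vec K \<and> (\<forall>i<K. 0 \<le> v $ i)
     \<and> vs \<in> carrier_vec (K + 1) \<and> (\<forall>i\<le>K. 0 \<le> vs $ i)
     \<and> u \<in> carrier_vec K \<and> (\<forall>i<K. 0 \<le> u $ i)
     \<and> D_equality K v vs
     \<and> psd (2 * K + 2) (D_matrix K L \<alpha> \<tau> v vs u)"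

definition D_objective :: "nat \<Rightarrow> real \<Rightarrow> real vec \<Rightarrow> real \<Rightarrow> real vec \<Rightarrow> real" where
  "D_objective K R b \<tau> u = \<tau> * R\<^sup>2 + (\<Sum>i<K. u $ i * (b $ i)\<^sup>2)"

definition v_fix :: "nat \<Rightarrow> (nat \<Rightarrow> real) \<Rightarrow> real vec" where
  "v_fix K \<alpha> = vec K (\<lambda>i. partial_sum \<alpha> i / partial_sum \<alpha> K)"

definition vs_fix :: "nat \<Rightarrow> (nat \<Rightarrow> real) \<Rightarrow> real vec" where
  "vs_fix K \<alpha> = vec (K + 1) (\<lambda>i.
     if i = 0 then v_fix K \<alpha> $ 0
     else if i < K then v_fix K \<alpha> $ i - v_fix K \<alpha> $ (i - 1)
     else 1 - v_fix K \<alpha> $ (K - 1))"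

(* The restricted problem only fixes v; vs stays a variable (tau, vs, u), so that its
   being determined by the equality constraint is not built into the problem. *)
fun restricted_feasible ::
  "nat \<Rightarrow> real \<Rightarrow> (nat \<Rightarrow> real) \<Rightarrow> real \<times> real vec \<times> real vec \<Rightarrow> bool" where
  "restricted_feasible K L \<alpha> (\<tau>, vs, u) = D_feasible K L \<alpha> \<tau> (v_fix K \<alpha>) vs u"

fun restricted_objective :: "nat \<Rightarrow> real \<Rightarrow> real vec \<Rightarrow> real \<times> real vec \<times> real vec \<Rightarrow> real" where
  "restricted_objective K R b (\<tau>, vs, u) = D_objective K R b \<tau> u"

(* The columns of B and the rows and columns of D are indexed by 1, ..., K;
   the matrix index j < K stands for j + 1. *)
definition D_diag :: "nat \<Rightarrow> real \<Rightarrow> (nat \<Rightarrow> real) \<Rightarrow> real mat" where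
  "D_diag K L \<alpha> = mat_diag K (\<lambda>j.
     (partial_sum \<alpha> (j + 1) - (\<alpha> (j + 1))\<^sup>2) / (L * partial_sum \<alpha> K))"

definition B_bar :: "nat \<Rightarrow> real \<Rightarrow> (nat \<Rightarrow> real) \<Rightarrow> real mat" where
  "B_bar K L \<alpha> = mat K K (\<lambda>(i, c). let j = c + 1 in
     if j = i + 1 then (2 * \<alpha> i * \<alpha> (i + 1) + partial_sum \<alpha> i) / (2 * L * partial_sum \<alpha> K)
     else if j \<ge> i + 2 then \<alpha> i * \<alpha> j / (L * partial_sum \<alpha> K)
     else 0)"

definition H_mat :: "nat \<Rightarrow> real \<Rightarrow> (nat \<Rightarrow> real) \<Rightarrow> real mat" where
  "H_mat K L \<alpha> = B_bar K L \<alpha> * the (mat_inverse (D_diag K L \<alpha>)) * transpose_mat (B_bar K L \<alpha>)"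

definition u_hat :: "nat \<Rightarrow> real \<Rightarrow> (nat \<Rightarrow> real) \<Rightarrow> real vec \<Rightarrow> real vec" where
  "u_hat K L \<alpha> b = vec K (\<lambda>i. (H_mat K L \<alpha> *\<^sub>v b) $ i / b $ i)"

(* So the value of mat_inverse in H_mat is never None when all A_k - alpha_k^2 > 0. *)
lemma mat_inverse_mat_diag:
  fixes f :: "nat \<Rightarrow> 'a :: field"
  assumes "\<And>i. i < n \<Longrightarrow> f i \<noteq> 0"
  shows "mat_inverse (mat_diag n f) = Some (mat_diag n (\<lambda>i. 1 / f i))"
proof -
  let ?D = "mat_diag n f" and ?E = "mat_diag n (\<lambda>i. 1 / f i)"
  have DE: "?D * ?E = 1\<^sub>m n" and ED: "?E * ?D = 1\<^sub>m n"
    unfolding mat_diag_diag using assms by (auto simp: mat_diag_def intro!: eq_matI)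
  have "?D \<in> Units (ring_mat TYPE('a) n ())"
    unfolding Units_def ring_mat_simps using DE ED mat_diag_dim by blast
  then obtain B where B: "mat_inverse ?D = Some B"
    using mat_inverse(1)[of ?D n "()"] by (cases "mat_inverse ?D") auto
  then have BD: "B * ?D = 1\<^sub>m n" and carB: "B \<in> carrier_mat n n"
    using mat_inverse(2)[OF mat_diag_dim B] by auto
  have "B = B * (?D * ?E)"
    unfolding DE using carB by simp
  also have "\<dots> = (B * ?D) * ?E"
    using assoc_mult_mat[OF carB mat_diag_dim mat_diag_dim] by simp
  also have "\<dots> = ?E"
    unfolding BD by (rule left_mult_one_mat[OF mat_diag_dim])
  finally have "B = ?E" .
  with B show ?thesis by simp
qed

lemma index_msum:
  assumes "finite S" "\<And>s. s \<in> S \<Longrightarrow> f s \<in> carrier_mat n n" "i < n" "j < n"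
  shows "msum n f S $$ (i, j) = (\<Sum>s\<in>S. f s $$ (i, j))"
proof -
  interpret ring "ring_mat TYPE(real) n ()" by (rule ring_mat)
  have "msum n f S \<in> carrier_mat n n \<and> msum n f S $$ (i, j) = (\<Sum>s\<in>S. f s $$ (i, j))"
    using assms
  proof (induction S rule: finite_induct)
    case empty
    then show ?case by (simp add: ring_mat_simps)
  next
    case (insert x S)
    have "msum n f (insert x S) = f x + msum n f S"
      using insert.prems insert.hyps by (subst finsum_insert) (auto simp: ring_mat_simps)
    with insert show ?case by auto
  qed
  then show ?thesis by blast
qed

end

theory Submission
  imports Defs
begin

text \<open>
  With the multipliers fixed, the coefficient of \<open>g\<^sub>k\<close> in the quadratic form of the dual matrix
  involves the iterates only through \<open>A\<^sub>k x\<^sub>k - A\<^sub>k\<^sub>-\<^sub>1 x\<^sub>k\<^sub>-\<^sub>1\<close>, in which the recursion for \<open>\<theta>\<close> telescopes.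
  Writing \<open>S = \<Sum> \<alpha>\<^sub>k g\<^sub>k\<close>, the form becomes
  \<open>\<tau> x\<^sub>0\<^sup>2 - x\<^sub>0 S / A\<^sub>K + S\<^sup>2 / (L A\<^sub>K) + \<Sum> (d\<^sub>k g\<^sub>k\<^sup>2 + 2 g\<^sub>k (B\<^sup>T e)\<^sub>k) + \<Sum> u\<^sub>i e\<^sub>i\<^sup>2\<close>,
  the last-but-one sum being over \<open>k \<ge> 1\<close>. Since \<open>\<alpha>\<^sub>0 = 1\<close> and \<open>g\<^sub>0\<close> occurs only in \<open>S\<close>, the variable
  \<open>S\<close> is free, and completing squares shows that the matrix is positive semidefinite iff
  \<open>\<tau> \<ge> L / (4 A\<^sub>K)\<close> and \<open>diag u - H\<close> is positive semidefinite. Evaluating the latter at \<open>b\<close> bounds the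
  objective from below. As \<open>H\<close> is entrywise nonnegative, \<open>u\<^sub>i = (H b)\<^sub>i / b\<^sub>i\<close> is admissible and attains
  the bound; conversely, if the bound is attained then \<open>b\<close> minimizes the form of \<open>diag u - H\<close>, so
  \<open>(diag u - H) b = 0\<close>, which determines \<open>u\<close>.
\<close>

section \<open>Quadratic forms and symmetry of sums, scalings and outer products\<close>

lemma msum_carrier [simp]:
  assumes "\<And>s. s \<in> S \<Longrightarrow> f s \<in> carrier_mat n n"
  shows "msum n f S \<in> carrier_mat n n"
proof -
  interpret ring "ring_mat TYPE(real) n ()" by (rule ring_mat)
  show ?thesis using assms finsum_closed[of f S] by (auto simp: ring_mat_simps)
qed

lemma quad_eq_sum:
  fixes M :: "real mat"
  assumes "M \<in> carrier_mat n n" "x \<in> carrier_vec n"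
  shows "x \<bullet> (M *\<^sub>v x) = (\<Sum>i<n. \<Sum>j<n. x $ i * M $$ (i, j) * x $ j)"
  using assms
  by (auto simp: scalar_prod_def sum_distrib_left atLeast0LessThan mult.assoc intro!: sum.cong)

lemma quad_add:
  fixes M :: "real mat"
  assumes "M \<in> carrier_mat n n" "N \<in> carrier_mat n n" "x \<in> carrier_vec n"
  shows "x \<bullet> ((M + N) *\<^sub>v x) = x \<bullet> (M *\<^sub>v x) + x \<bullet> (N *\<^sub>v x)"
  using assms by (simp add: add_mult_distrib_mat_vec[of _ n n] scalar_prod_add_distrib[of _ n])

lemma quad_smult:
  fixes M :: "real mat"
  assumes "M \<in> carrier_mat n n" "x \<in> carrier_vec n"
  shows "x \<bullet> ((c \<cdot>\<^sub>m M) *\<^sub>v x) = c * (x \<bullet> (M *\<^sub>v x))"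
  using assms by (simp add: quad_eq_sum[of _ n] sum_distrib_left algebra_simps)

lemma quad_msum:
  assumes "finite S" "\<And>s. s \<in> S \<Longrightarrow> f s \<in> carrier_mat n n" "x \<in> carrier_vec n"
  shows "x \<bullet> (msum n f S *\<^sub>v x) = (\<Sum>s\<in>S. x \<bullet> (f s *\<^sub>v x))"
proof -
  have "x \<bullet> (msum n f S *\<^sub>v x) = (\<Sum>i<n. \<Sum>j<n. \<Sum>s\<in>S. x $ i * f s $$ (i, j) * x $ j)"
    using assms by (simp add: quad_eq_sum[of _ n] index_msum sum_distrib_left sum_distrib_right)
  also have "\<dots> = (\<Sum>i<n. \<Sum>s\<in>S. \<Sum>j<n. x $ i * f s $$ (i, j) * x $ j)"
    by (intro sum.cong refl sum.swap)
  also have "\<dots> = (\<Sum>s\<in>S. \<Sum>i<n. \<Sum>j<n. x $ i * f s $$ (i, j) * x $ j)"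
    by (rule sum.swap)
  also have "\<dots> = (\<Sum>s\<in>S. x \<bullet> (f s *\<^sub>v x))"
    using assms by (intro sum.cong) (simp_all add: quad_eq_sum[of _ n])
  finally show ?thesis .
qed

lemma outer_carrier [simp]:
  "u \<in> carrier_vec n \<Longrightarrow> v \<in> carrier_vec m \<Longrightarrow> outer u v \<in> carrier_mat n m"
  by (auto simp: outer_def)

lemma quad_outer:
  assumes "u \<in> carrier_vec n" "v \<in> carrier_vec n" "x \<in> carrier_vec n"
  shows "x \<bullet> (outer u v *\<^sub>v x) = (x \<bullet> u) * (x \<bullet> v)"
proof -
  have "x \<bullet> (outer u v *\<^sub>v x) = (\<Sum>i<n. \<Sum>j<n. x $ i * (u $ i * v $ j) * x $ j)"
    using assms by (subst quad_eq_sum[of _ n]) (auto simp: outer_def)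
  also have "\<dots> = (\<Sum>i<n. \<Sum>j<n. (x $ i * u $ i) * (x $ j * v $ j))"
    by (intro sum.cong) (simp_all add: algebra_simps)
  also have "\<dots> = (x \<bullet> u) * (x \<bullet> v)"
    using assms by (simp add: scalar_prod_def sum_product atLeast0LessThan)
  finally show ?thesis .
qed

lemma symmetric_mat_outer_swap:
  assumes "u \<in> carrier_vec n" "v \<in> carrier_vec n"
  shows "transpose_mat (outer u v + outer v u) = outer u v + outer v u"
  using assms by (auto simp: outer_def)

lemma symmetric_mat_outer: "transpose_mat (outer u u) = outer u u"
  by (auto simp: outer_def)

lemma symmetric_mat_add:
  assumes "M \<in> carrier_mat n n" "N \<in> carrier_mat n n"
    "transpose_mat M = M" "transpose_mat N = N"
  shows "transpose_mat (M + N) = M + N"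
  using transpose_add[OF assms(1,2)] assms(3,4) by simp

lemma symmetric_mat_smult:
  assumes "transpose_mat M = (M :: real mat)"
  shows "transpose_mat (c \<cdot>\<^sub>m M) = c \<cdot>\<^sub>m M"
proof -
  have "transpose_mat (c \<cdot>\<^sub>m M) = c \<cdot>\<^sub>m transpose_mat M" by auto
  with assms show ?thesis by simp
qed

lemma symmetric_msum:
  assumes "finite S" "\<And>s. s \<in> S \<Longrightarrow> f s \<in> carrier_mat n n"
    "\<And>s. s \<in> S \<Longrightarrow> transpose_mat (f s) = f s"
  shows "transpose_mat (msum n f S) = msum n f S"
proof (rule eq_matI)
  have M: "msum n f S \<in> carrier_mat n n" using assms by simp
  fix i j assume "i < dim_row (msum n f S)" "j < dim_col (msum n f S)"
  with M have ij: "i < n" "j < n" by auto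
  have "f s $$ (j, i) = f s $$ (i, j)" if "s \<in> S" for s
    using assms(2,3)[OF that] ij by (metis carrier_matD index_transpose_mat(1))
  then show "transpose_mat (msum n f S) $$ (i, j) = msum n f S $$ (i, j)"
    using carrier_matD[OF M] ij assms(1,2) index_msum[of S f n i j] index_msum[of S f n j i] by simp
qed (use carrier_matD[OF msum_carrier[of S f n]] assms in auto)

lemma scalar_prod_vsum:
  assumes "finite S" "\<And>s. s \<in> S \<Longrightarrow> f s \<in> carrier_vec n" "x \<in> carrier_vec n"
  shows "x \<bullet> vsum n f S = (\<Sum>s\<in>S. x \<bullet> f s)"
proof -
  have V: "vsum n f S \<in> carrier_vec n" using assms by (intro finsum_vec_closed) auto
  have "x \<bullet> vsum n f S = (\<Sum>i<n. \<Sum>s\<in>S. x $ i * f s $ i)"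
    using assms V unfolding scalar_prod_def
    by (auto simp: atLeast0LessThan sum_distrib_left Pi_def index_finsum_vec intro!: sum.cong)
  also have "\<dots> = (\<Sum>s\<in>S. \<Sum>i<n. x $ i * f s $ i)" by (rule sum.swap)
  also have "\<dots> = (\<Sum>s\<in>S. x \<bullet> f s)"
    using assms by (intro sum.cong) (auto simp: scalar_prod_def atLeast0LessThan dest: carrier_vecD)
  finally show ?thesis .
qed

subsection \<open>Nonnegative symmetric forms dominated by a diagonal form\<close>

text \<open>Right side minus left side is half the sum of the nonnegative terms
  \<open>h i j * b i * b j * (e i / b i - e j / b j)^2\<close>. All of them vanish at
  \<open>e = b\<close>, so this diagonal majorant touches the form there.\<close>

lemma nonneg_form_le_diagonal:
  fixes h :: "nat \<Rightarrow> nat \<Rightarrow> real" and b e :: "nat \<Rightarrow> real"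
  assumes h: "\<And>i j. i < n \<Longrightarrow> j < n \<Longrightarrow> 0 \<le> h i j"
    and sym: "\<And>i j. i < n \<Longrightarrow> j < n \<Longrightarrow> h i j = h j i"
    and b: "\<And>i. i < n \<Longrightarrow> 0 < b i"
  shows "(\<Sum>i<n. \<Sum>j<n. h i j * e i * e j) \<le> (\<Sum>i<n. (\<Sum>j<n. h i j * b j) / b i * (e i)\<^sup>2)"
proof -
  let ?r = "\<Sum>i<n. \<Sum>j<n. h i j * b j / b i * (e i)\<^sup>2"
  have "0 \<le> (\<Sum>i<n. \<Sum>j<n. h i j * b i * b j * (e i / b i - e j / b j)\<^sup>2)"
    using h b by (intro sum_nonneg mult_nonneg_nonneg) (auto simp: less_imp_le)
  \<comment> \<open>By symmetry the second term is written with \<open>h j i\<close>; exchanging the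
    two summations then makes it a copy of the first.\<close>
  also have "\<dots> = (\<Sum>i<n. \<Sum>j<n. h i j * b j / b i * (e i)\<^sup>2 + h j i * b i / b j * (e j)\<^sup>2
      - 2 * (h i j * e i * e j))"
  proof (intro sum.cong refl)
    fix i j assume "i \<in> {..<n}" "j \<in> {..<n}"
    then have "b i \<noteq> 0" "b j \<noteq> 0" "h j i = h i j" using b[of i] b[of j] sym[of i j] by auto
    then show "h i j * b i * b j * (e i / b i - e j / b j)\<^sup>2
        = h i j * b j / b i * (e i)\<^sup>2 + h j i * b i / b j * (e j)\<^sup>2 - 2 * (h i j * e i * e j)"
      by (simp add: field_simps power2_eq_square)
  qed
  also have "\<dots> = ?r + (\<Sum>i<n. \<Sum>j<n. h j i * b i / b j * (e j)\<^sup>2)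
      - 2 * (\<Sum>i<n. \<Sum>j<n. h i j * e i * e j)"
    by (simp add: sum.distrib sum_subtractf sum_distrib_left)
  also have "(\<Sum>i<n. \<Sum>j<n. h j i * b i / b j * (e j)\<^sup>2) = ?r" by (rule sum.swap)
  finally show ?thesis by (simp add: sum_distrib_right sum_divide_distrib)
qed

lemma linear_coeff_zero_if_quadratic_nonneg:
  fixes p q :: real
  assumes "\<And>t. 0 \<le> p * t + q * t\<^sup>2"
  shows "p = 0"
proof (rule ccontr)
  assume p: "p \<noteq> 0"
  \<comment> \<open>Any positive \<open>s\<close> above \<open>q\<close> works: at
    \<open>t = - p / s\<close> the linear term outweighs the quadratic one and the value is
    negative.\<close>
  define s where "s = \<bar>q\<bar> + 1"
  have s: "s > 0" "q < s" by (auto simp: s_def)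
  have "p * (- p / s) + q * (- p / s)\<^sup>2 = p\<^sup>2 / s\<^sup>2 * (q - s)"
    using s by (simp add: field_simps power2_eq_square)
  also have "\<dots> < 0" using p s by (intro mult_pos_neg) auto
  finally show False using assms[of "- p / s"] by simp
qed

text \<open>The diagonal form minus the form of \<open>h\<close> is nonnegative and zero at
  \<open>b\<close>, so \<open>b\<close> minimizes it and its partial derivative in direction
  \<open>k\<close> vanishes there. This is the source of the uniqueness of \<open>u\<close>.\<close>

lemma diagonal_form_contact:
  fixes h :: "nat \<Rightarrow> nat \<Rightarrow> real" and b u :: "nat \<Rightarrow> real"
  assumes sym: "\<And>i j. i < n \<Longrightarrow> j < n \<Longrightarrow> h i j = h j i"
    and dom: "\<And>e. (\<Sum>i<n. \<Sum>j<n. h i j * e i * e j) \<le> (\<Sum>i<n. u i * (e i)\<^sup>2)"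
    and eq: "(\<Sum>i<n. \<Sum>j<n. h i j * b i * b j) = (\<Sum>i<n. u i * (b i)\<^sup>2)"
    and k: "k < n"
  shows "u k * b k = (\<Sum>j<n. h k j * b j)"
proof -
  let ?w = "\<lambda>i. if i = k then 1 else 0 :: real"
  \<comment> \<open>This is the difference of the two forms at \<open>b\<close> plus
    \<open>t\<close> times the \<open>k\<close>-th unit vector; its constant term is zero by
    \<open>eq\<close>.\<close>
  have diff: "0 \<le> 2 * (u k * b k - (\<Sum>j<n. h k j * b j)) * t + (u k - h k k) * t\<^sup>2" for t :: real
  proof -
    let ?e = "\<lambda>i. b i + t * ?w i"
    have "(\<Sum>i<n. u i * (?e i)\<^sup>2)
        = (\<Sum>i<n. u i * (b i)\<^sup>2 + (if i = k then u k * (2 * t * b k + t\<^sup>2) else 0))"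
      by (intro sum.cong) (auto simp: power2_eq_square algebra_simps)
    then have U: "(\<Sum>i<n. u i * (?e i)\<^sup>2) = (\<Sum>i<n. u i * (b i)\<^sup>2) + u k * (2 * t * b k + t\<^sup>2)"
      using k by (simp add: sum.distrib)
    have "(\<Sum>i<n. \<Sum>j<n. h i j * ?e i * ?e j)
        = (\<Sum>i<n. \<Sum>j<n. h i j * b i * b j + (if j = k then t * (h i k * b i) else 0)
            + (if i = k then t * (h k j * b j) else 0)
            + (if j = k then (if i = k then t\<^sup>2 * h k k else 0) else 0))"
      by (intro sum.cong refl) (auto simp: algebra_simps power2_eq_square)
    also have "\<dots> = (\<Sum>i<n. (\<Sum>j<n. h i j * b i * b j) + t * (h i k * b i)
            + (if i = k then t * (\<Sum>j<n. h k j * b j) else 0)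
            + (if i = k then t\<^sup>2 * h k k else 0))"
      using k by (intro sum.cong refl) (auto simp: sum.distrib sum_distrib_left)
    also have "\<dots> = (\<Sum>i<n. \<Sum>j<n. h i j * b i * b j) + t * (\<Sum>i<n. h i k * b i)
            + t * (\<Sum>j<n. h k j * b j) + t\<^sup>2 * h k k"
      using k by (simp add: sum.distrib sum_distrib_left)
    also have "(\<Sum>i<n. h i k * b i) = (\<Sum>j<n. h k j * b j)"
      using sym k by (intro sum.cong) auto
    finally have "(\<Sum>i<n. \<Sum>j<n. h i j * ?e i * ?e j)
        = (\<Sum>i<n. \<Sum>j<n. h i j * b i * b j) + 2 * t * (\<Sum>j<n. h k j * b j) + t\<^sup>2 * h k k"
      by simp
    with U dom[of ?e] eq show ?thesis by (simp add: algebra_simps)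
  qed
  from linear_coeff_zero_if_quadratic_nonneg[OF diff] show ?thesis by simp
qed

subsection \<open>The telescoping identity\<close>

lemma partial_sum_Suc: "partial_sum \<alpha> (Suc k) = partial_sum \<alpha> k + \<alpha> (Suc k)"
  by (simp add: partial_sum_def)

text \<open>Multiplied by its denominator, the recursion for \<open>theta\<close> reproduces the old
  coefficients scaled by \<open>partial_sum \<alpha> k\<close>, plus a rank-one part in
  \<open>\<alpha>\<close>. Hence the step between scaled iterates contains no \<open>theta\<close>.
  Here \<open>h\<close> stands for gradient plus error.\<close>

lemma scaled_iterate_step:
  fixes \<alpha> h :: "nat \<Rightarrow> real" and r x\<^sub>0 :: real
  defines "x \<equiv> \<lambda>k. x\<^sub>0 - r * (\<Sum>i<k. theta \<alpha> k i * h i)"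
  assumes "partial_sum \<alpha> (Suc k) \<noteq> 0"
  shows "partial_sum \<alpha> (Suc k) * x (Suc k) = partial_sum \<alpha> k * x k + \<alpha> (Suc k) * x\<^sub>0
    - r * (2 * \<alpha> (Suc k) * (\<Sum>i\<le>k. \<alpha> i * h i) + partial_sum \<alpha> k * h k)"
proof -
  have "partial_sum \<alpha> (Suc k) * (\<Sum>i<k. theta \<alpha> (Suc k) i * h i)
      = (\<Sum>i<k. 2 * \<alpha> (Suc k) * (\<alpha> i * h i) + partial_sum \<alpha> k * (theta \<alpha> k i * h i))"
    using assms(2) by (auto simp: sum_distrib_left field_simps intro!: sum.cong)
  also have "\<dots> = 2 * \<alpha> (Suc k) * (\<Sum>i<k. \<alpha> i * h i)
      + partial_sum \<alpha> k * (\<Sum>i<k. theta \<alpha> k i * h i)"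
    by (simp add: sum.distrib sum_distrib_left)
  finally have low: "partial_sum \<alpha> (Suc k) * (\<Sum>i<k. theta \<alpha> (Suc k) i * h i) = \<dots>" .
  \<comment> \<open>The newest coefficient has its own formula: one part extends the rank-one sum to
    \<open>i = k\<close>, the other leaves the extra
    \<open>partial_sum \<alpha> k * h k\<close>.\<close>
  have top: "partial_sum \<alpha> (Suc k) * theta \<alpha> (Suc k) k = 2 * \<alpha> k * \<alpha> (Suc k) + partial_sum \<alpha> k"
    using assms(2) by simp
  have "partial_sum \<alpha> (Suc k) * (\<Sum>i<Suc k. theta \<alpha> (Suc k) i * h i)
      = partial_sum \<alpha> (Suc k) * (\<Sum>i<k. theta \<alpha> (Suc k) i * h i)
      + partial_sum \<alpha> (Suc k) * theta \<alpha> (Suc k) k * h k"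
    by (simp add: distrib_left del: theta.simps)
  also have "\<dots> = 2 * \<alpha> (Suc k) * (\<Sum>i\<le>k. \<alpha> i * h i) + partial_sum \<alpha> k * h k
      + partial_sum \<alpha> k * (\<Sum>i<k. theta \<alpha> k i * h i)"
    unfolding low top lessThan_Suc_atMost[symmetric] sum.lessThan_Suc by (simp add: algebra_simps)
  finally have "partial_sum \<alpha> (Suc k) * (\<Sum>i<Suc k. theta \<alpha> (Suc k) i * h i) = \<dots>" .
  moreover have "partial_sum \<alpha> (Suc k) * x (Suc k) = partial_sum \<alpha> (Suc k) * x\<^sub>0
      - r * (partial_sum \<alpha> (Suc k) * (\<Sum>i<Suc k. theta \<alpha> (Suc k) i * h i))"
    unfolding x_def by (simp add: right_diff_distrib del: theta.simps sum.lessThan_Suc)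
  ultimately show ?thesis
    unfolding x_def by (simp add: partial_sum_Suc algebra_simps del: theta.simps sum.lessThan_Suc)
qed

text \<open>Induction on \<open>n\<close>, with the multipliers scaled by
  \<open>partial_sum \<alpha> n\<close> to clear denominators and \<open>r\<close> standing for
  \<open>1 / L\<close>. The separate \<open>(g n)^2\<close> term on the left is the scaled final
  gradient term of the dual matrix; its change with \<open>n\<close> balances each
  increment.\<close>

lemma multiplier_sum_identity:
  fixes \<alpha> e g :: "nat \<Rightarrow> real" and r x\<^sub>0 :: real
  defines "x \<equiv> \<lambda>k. x\<^sub>0 - r * (\<Sum>i<k. theta \<alpha> k i * (g i + e i))"
  assumes "\<And>k. k < n \<Longrightarrow> partial_sum \<alpha> (Suc k) \<noteq> 0"
  shows "(\<Sum>i<n. partial_sum \<alpha> i * ((x i - x (Suc i)) * g (Suc i) + r / 2 * (g i - g (Suc i))\<^sup>2))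
      + (\<Sum>i\<le>n. \<alpha> i * (- x i * g i + r / 2 * (g i)\<^sup>2)) + partial_sum \<alpha> n * (r / 2) * (g n)\<^sup>2
    = - x\<^sub>0 * (\<Sum>i\<le>n. \<alpha> i * g i) + r * (\<Sum>i\<le>n. \<alpha> i * g i)\<^sup>2
      + r * (\<Sum>i\<le>n. (partial_sum \<alpha> i - (\<alpha> i)\<^sup>2) * (g i)\<^sup>2)
      + r * (\<Sum>k<n. g (Suc k) * (2 * \<alpha> (Suc k) * (\<Sum>i\<le>k. \<alpha> i * e i) + partial_sum \<alpha> k * e k))"
  using assms(2)
proof (induction n)
  case 0
  show ?case by (simp add: x_def partial_sum_def power2_eq_square algebra_simps)
next
  case (Suc n)
  have step: "partial_sum \<alpha> (Suc n) * x (Suc n) = partial_sum \<alpha> n * x n + \<alpha> (Suc n) * x\<^sub>0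
    - r * (2 * \<alpha> (Suc n) * ((\<Sum>i\<le>n. \<alpha> i * g i) + (\<Sum>i\<le>n. \<alpha> i * e i))
        + partial_sum \<alpha> n * (g n + e n))"
    using scaled_iterate_step[of \<alpha> n x\<^sub>0 r "\<lambda>i. g i + e i"] Suc.prems
    by (simp add: x_def sum.distrib algebra_simps)
  \<comment> \<open>Increment of the left side: the weights on \<open>x (Suc n)\<close> add up to
    \<open>partial_sum \<alpha> (Suc n)\<close>, so exactly the difference of scaled iterates from
    \<open>step\<close> appears.\<close>
  have "partial_sum \<alpha> n * ((x n - x (Suc n)) * g (Suc n) + r / 2 * (g n - g (Suc n))\<^sup>2)
      + \<alpha> (Suc n) * (- x (Suc n) * g (Suc n) + r / 2 * (g (Suc n))\<^sup>2)
      + partial_sum \<alpha> (Suc n) * (r / 2) * (g (Suc n))\<^sup>2 - partial_sum \<alpha> n * (r / 2) * (g n)\<^sup>2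
    = g (Suc n) * (partial_sum \<alpha> n * x n - partial_sum \<alpha> (Suc n) * x (Suc n))
      + r * partial_sum \<alpha> (Suc n) * (g (Suc n))\<^sup>2 - r * partial_sum \<alpha> n * g n * g (Suc n)"
    by (simp add: partial_sum_Suc power2_eq_square field_simps)
  \<comment> \<open>The mixed term in \<open>g n * g (Suc n)\<close> cancels. Subtracting
    \<open>(\<alpha> (Suc n))^2\<close> from the diagonal coefficient pays for completing the
    increment of the squared sum.\<close>
  also have "\<dots> = - x\<^sub>0 * (\<alpha> (Suc n) * g (Suc n))
      + r * (2 * (\<Sum>i\<le>n. \<alpha> i * g i) * (\<alpha> (Suc n) * g (Suc n)) + (\<alpha> (Suc n) * g (Suc n))\<^sup>2)
      + r * (partial_sum \<alpha> (Suc n) - (\<alpha> (Suc n))\<^sup>2) * (g (Suc n))\<^sup>2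
      + r * (g (Suc n) * (2 * \<alpha> (Suc n) * (\<Sum>i\<le>n. \<alpha> i * e i) + partial_sum \<alpha> n * e n))"
    unfolding step by (simp add: power2_eq_square algebra_simps)
  finally show ?case
    using Suc.IH Suc.prems by (simp add: power2_eq_square algebra_simps)
qed

subsection \<open>The dual matrix as a quadratic form\<close>

text \<open>Otherwise the simplifier rewrites the dimension \<open>2 * K + 2\<close> and the carrier rules no longer match.\<close>

declare add_2_eq_Suc [simp del] add_2_eq_Suc' [simp del]

lemma e_vec_carrier [simp]: "e_vec K i \<in> carrier_vec (2 * K + 2)"
  by (simp add: e_vec_def)

lemma g_vec_carrier [simp]: "g_vec K p \<in> carrier_vec (2 * K + 2)"
  by (cases p) simp_all

lemma x_vec_carrier [simp]: "x_vec K L \<alpha> p \<in> carrier_vec (2 * K + 2)"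
  by (cases p)
    (auto intro!: finsum_vec_closed minus_carrier_vec add_carrier_vec simp del: g_vec.simps)

declare g_vec.simps [simp del] x_vec.simps [simp del]

lemma A_mat_carrier [simp]: "A_mat K L \<alpha> p q \<in> carrier_mat (2 * K + 2) (2 * K + 2)"
  unfolding A_mat_def
  by (intro add_carrier_mat smult_carrier_mat outer_carrier minus_carrier_vec) simp_all

lemma symmetric_A_mat: "transpose_mat (A_mat K L \<alpha> p q) = A_mat K L \<alpha> p q"
  unfolding A_mat_def
  by (rule symmetric_mat_add[of _ "2 * K + 2"])
    (auto intro!: symmetric_mat_smult symmetric_mat_outer_swap[of _ "2 * K + 2"] symmetric_mat_outer
      outer_carrier minus_carrier_vec add_carrier_mat smult_carrier_mat)

lemma D_matrix_carrier [simp]: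
  "D_matrix K L \<alpha> \<tau> v vs u \<in> carrier_mat (2 * K + 2) (2 * K + 2)"
  unfolding D_matrix_def
  by (intro add_carrier_mat smult_carrier_mat outer_carrier msum_carrier) simp_all

lemma symmetric_D_matrix:
  "transpose_mat (D_matrix K L \<alpha> \<tau> v vs u) = D_matrix K L \<alpha> \<tau> v vs u"
  unfolding D_matrix_def
  by (intro symmetric_mat_add[of _ "2 * K + 2"] symmetric_mat_smult symmetric_msum
      symmetric_mat_outer symmetric_A_mat
      add_carrier_mat smult_carrier_mat outer_carrier msum_carrier) simp_all

text \<open>The two transposed outer products give the same value, which absorbs the factor one
  half.\<close>

lemma quad_A_mat:
  assumes "z \<in> carrier_vec (2 * K + 2)"
  shows "z \<bullet> (A_mat K L \<alpha> p q *\<^sub>v z)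
    = (z \<bullet> x_vec K L \<alpha> p - z \<bullet> x_vec K L \<alpha> q) * (z \<bullet> g_vec K q)
      + 1 / (2 * L) * (z \<bullet> g_vec K p - z \<bullet> g_vec K q)\<^sup>2"
  unfolding A_mat_def
  by (subst quad_add[of _ "2 * K + 2"] quad_smult[of _ "2 * K + 2"] quad_outer[of _ "2 * K + 2"],
      use assms in \<open>auto intro!: add_carrier_mat smult_carrier_mat outer_carrier minus_carrier_vec
        simp: scalar_prod_minus_distrib[of _ "2 * K + 2"] power2_eq_square\<close>)+

lemma quad_D_matrix:
  assumes z: "z \<in> carrier_vec (2 * K + 2)"
  shows "z \<bullet> (D_matrix K L \<alpha> \<tau> v vs u *\<^sub>v z)
    = (\<Sum>i<K. v $ i * (z \<bullet> (A_mat K L \<alpha> (Iter i) (Iter (i + 1)) *\<^sub>v z)))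
      + (\<Sum>i\<le>K. vs $ i * (z \<bullet> (A_mat K L \<alpha> Star (Iter i) *\<^sub>v z)))
      + \<tau> * (z \<bullet> x_vec K L \<alpha> (Iter 0))\<^sup>2
      + (\<Sum>i<K. u $ i * (z \<bullet> e_vec K i)\<^sup>2)
      + 1 / (2 * L) * (z \<bullet> g_vec K (Iter K))\<^sup>2"
proof -
  let ?n = "2 * K + 2"
  note carrier = add_carrier_mat smult_carrier_mat outer_carrier msum_carrier
  have outer: "z \<bullet> ((c \<cdot>\<^sub>m outer w w) *\<^sub>v z) = c * (z \<bullet> w)\<^sup>2" if "w \<in> carrier_vec ?n" for c w
    using that z by (simp add: quad_smult[of _ ?n] quad_outer[of _ ?n] outer_carrier power2_eq_square)
  have v: "z \<bullet> (msum ?n (\<lambda>i. c i \<cdot>\<^sub>m M i) S *\<^sub>v z) = (\<Sum>i\<in>S. c i * (z \<bullet> (M i *\<^sub>v z)))"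
    if "finite S" "\<And>i. M i \<in> carrier_mat ?n ?n" for c M and S :: "nat set"
    using that z by (simp add: quad_msum[of _ _ ?n] quad_smult[of _ ?n])
  have u: "z \<bullet> (msum ?n (\<lambda>i. u $ i \<cdot>\<^sub>m outer (e_vec K i) (e_vec K i)) {..<K} *\<^sub>v z)
      = (\<Sum>i<K. u $ i * (z \<bullet> e_vec K i)\<^sup>2)"
    using z by (subst v) (auto simp: quad_outer[of _ ?n] power2_eq_square intro!: outer_carrier)
  show ?thesis
    unfolding D_matrix_def using z
    by (subst quad_add[of _ ?n], (intro carrier; simp), (intro carrier; simp), simp)+
      (simp add: v u outer)
qed

lemma scalar_prod_e_vec:
  assumes "z \<in> carrier_vec (2 * K + 2)" "i < K"
  shows "z \<bullet> e_vec K i = z $ (1 + i)"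
  using assms by (simp add: e_vec_def)

lemma scalar_prod_g_vec:
  assumes "z \<in> carrier_vec (2 * K + 2)" "i \<le> K"
  shows "z \<bullet> g_vec K (Iter i) = z $ (1 + K + i)"
  using assms by (simp add: g_vec.simps)

lemma scalar_prod_x_vec:
  assumes z: "z \<in> carrier_vec (2 * K + 2)" and k: "k \<le> K"
  shows "z \<bullet> x_vec K L \<alpha> (Iter k)
    = z $ 0 - 1 / L * (\<Sum>i<k. theta \<alpha> k i * (z $ (1 + K + i) + z $ (1 + i)))"
proof -
  let ?n = "2 * K + 2"
  let ?f = "\<lambda>i. theta \<alpha> k i \<cdot>\<^sub>v (g_vec K (Iter i) + e_vec K i)"
  have f: "?f i \<in> carrier_vec ?n" for i
    by (intro smult_carrier_vec[THEN iffD2] add_carrier_vec) (rule g_vec_carrier e_vec_carrier)+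
  have V: "vsum ?n ?f {..<k} \<in> carrier_vec ?n" using f by (intro finsum_vec_closed) blast
  have "z \<bullet> (g_vec K (Iter i) + e_vec K i) = z $ (1 + K + i) + z $ (1 + i)" if "i < k" for i
    using z k that scalar_prod_e_vec[OF z, of i] scalar_prod_g_vec[OF z, of i]
    by (simp add: scalar_prod_add_distrib[of _ ?n] )
  then have "z \<bullet> vsum ?n ?f {..<k} = (\<Sum>i<k. theta \<alpha> k i * (z $ (1 + K + i) + z $ (1 + i)))"
    using f z by (subst scalar_prod_vsum) auto
  then show ?thesis
    using z V by (simp add: scalar_prod_minus_distrib[of _ ?n] x_vec.simps)
qed

lemma scalar_prod_Star [simp]:
  assumes "z \<in> carrier_vec (2 * K + 2)"
  shows "z \<bullet> x_vec K L \<alpha> Star = 0" "z \<bullet> g_vec K Star = 0"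
  using assms by (simp_all add: x_vec.simps g_vec.simps)

subsection \<open>The restricted problem\<close>

locale restricted_dual =
  fixes K :: nat and L :: real and \<alpha> :: "nat \<Rightarrow> real"
  assumes K: "1 \<le> K" and L: "0 < L" and \<alpha>0: "\<alpha> 0 = 1"
    and \<alpha>_nonneg: "\<And>k. 1 \<le> k \<Longrightarrow> k \<le> K \<Longrightarrow> 0 \<le> \<alpha> k"
    and gap: "\<And>k. 1 \<le> k \<Longrightarrow> k \<le> K \<Longrightarrow> 0 < partial_sum \<alpha> k - (\<alpha> k)\<^sup>2"
begin

abbreviation A where "A \<equiv> partial_sum \<alpha>"

text \<open>Diagonal entries of \<open>D_diag\<close>; the index \<open>c\<close> stands for
  \<open>c + 1\<close> in the mathematical numbering.\<close>

definition d where "d c = (A (c + 1) - (\<alpha> (c + 1))\<^sup>2) / (L * A K)"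

abbreviation B where "B i c \<equiv> B_bar K L \<alpha> $$ (i, c)"

abbreviation H where "H i j \<equiv> H_mat K L \<alpha> $$ (i, j)"

section \<open>Signs of the data and the entries of \<open>H\<close>\<close>

lemma \<alpha>_nonneg': "k \<le> K \<Longrightarrow> 0 \<le> \<alpha> k"
  using \<alpha>0 \<alpha>_nonneg[of k] by (cases k) auto

lemma A_pos: "k \<le> K \<Longrightarrow> 0 < A k"
  unfolding partial_sum_def using \<alpha>0 \<alpha>_nonneg' by (intro sum_pos2[of _ 0]) auto

lemma d_pos: "c < K \<Longrightarrow> 0 < d c"
  using gap[of "c + 1"] A_pos[of K] L by (simp add: d_def)

lemma B_nonneg: "i < K \<Longrightarrow> c < K \<Longrightarrow> 0 \<le> B i c"
  using \<alpha>_nonneg'[of i] \<alpha>_nonneg'[of "i + 1"] \<alpha>_nonneg'[of "c + 1"] A_pos[of K] A_pos[of i] L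
  by (simp add: B_bar_def)

text \<open>Column \<open>c\<close> vanishes below row \<open>c\<close>, and its entry in row
  \<open>c\<close> carries \<open>A c\<close> halved; doubling recovers the error coefficient of
  \<open>g (Suc c)\<close> in \<open>multiplier_sum_identity\<close>.\<close>

lemma B_column_sum:
  assumes "c < K"
  shows "2 * (\<Sum>i<K. B i c * e i)
    = (2 * \<alpha> (Suc c) * (\<Sum>i\<le>c. \<alpha> i * e i) + A c * e c) / (L * A K)"
proof -
  have "(\<Sum>i<K. B i c * e i) = (\<Sum>i<Suc c. B i c * e i)"
    using assms by (intro sum.mono_neutral_right) (auto simp: B_bar_def)
  also have "\<dots> = (\<Sum>i<c. \<alpha> i * \<alpha> (Suc c) / (L * A K) * e i)
      + (2 * \<alpha> c * \<alpha> (Suc c) + A c) / (2 * L * A K) * e c"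
    using assms by (simp add: B_bar_def)
  also have "(\<Sum>i<c. \<alpha> i * \<alpha> (Suc c) / (L * A K) * e i)
      = \<alpha> (Suc c) / (L * A K) * (\<Sum>i<c. \<alpha> i * e i)"
    by (simp add: sum_distrib_left sum_divide_distrib algebra_simps)
  finally show ?thesis
    using A_pos[of K] L by (simp add: lessThan_Suc_atMost[symmetric] field_simps)
qed

text \<open>Positivity of \<open>d\<close> makes the diagonal matrix invertible, so the option
  returned by \<open>mat_inverse\<close> is \<open>Some\<close> and its entries are the
  reciprocals.\<close>

lemma H_carrier [simp]: "H_mat K L \<alpha> \<in> carrier_mat K K"
  and H_entry: "i < K \<Longrightarrow> j < K \<Longrightarrow> H i j = (\<Sum>c<K. B i c * B j c / d c)"
proof -
  let ?E = "mat_diag K (\<lambda>c. 1 / d c)"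
  have B: "B_bar K L \<alpha> \<in> carrier_mat K K" by (simp add: B_bar_def)
  have "D_diag K L \<alpha> = mat_diag K d" by (simp add: D_diag_def d_def[abs_def])
  then have inv: "the (mat_inverse (D_diag K L \<alpha>)) = ?E"
    using mat_inverse_mat_diag[of K d] d_pos by fastforce
  have H: "H_mat K L \<alpha> = mat K K (\<lambda>(i, c). B i c * (1 / d c)) * transpose_mat (B_bar K L \<alpha>)"
    unfolding H_mat_def inv mat_diag_mult_right[OF B] ..
  show "H_mat K L \<alpha> \<in> carrier_mat K K" unfolding H by (rule mult_carrier_mat[of _ K K]) (use B in auto)
  show "H i j = (\<Sum>c<K. B i c * B j c / d c)" if "i < K" "j < K"
    unfolding H using that B by (simp add: scalar_prod_def atLeast0LessThan)
qed

lemma H_nonneg: "i < K \<Longrightarrow> j < K \<Longrightarrow> 0 \<le> H i j"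
  using B_nonneg d_pos by (auto simp: H_entry less_imp_le intro!: sum_nonneg)

lemma H_sym: "i < K \<Longrightarrow> j < K \<Longrightarrow> H i j = H j i"
  by (simp add: H_entry mult.commute)

text \<open>As \<open>H\<close> factors through the inverse diagonal, its form is a weighted sum of
  squares, precisely the remainder left by completing squares in the gradients.\<close>

lemma H_form: "(\<Sum>i<K. \<Sum>j<K. H i j * e i * e j) = (\<Sum>c<K. (\<Sum>i<K. B i c * e i)\<^sup>2 / d c)"
proof -
  have "(\<Sum>i<K. \<Sum>j<K. H i j * e i * e j)
      = (\<Sum>i<K. \<Sum>j<K. \<Sum>c<K. (B i c * e i) * (B j c * e j) / d c)"
    by (intro sum.cong refl) (simp add: H_entry sum_distrib_left sum_distrib_right algebra_simps)
  also have "\<dots> = (\<Sum>i<K. \<Sum>c<K. \<Sum>j<K. (B i c * e i) * (B j c * e j) / d c)"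
    by (intro sum.cong refl sum.swap)
  also have "\<dots> = (\<Sum>c<K. \<Sum>i<K. \<Sum>j<K. (B i c * e i) * (B j c * e j) / d c)"
    by (rule sum.swap)
  also have "\<dots> = (\<Sum>c<K. (\<Sum>i<K. B i c * e i)\<^sup>2 / d c)"
    by (simp add: power2_eq_square sum_product sum_divide_distrib)
  finally show ?thesis .
qed

section \<open>The multipliers forced by the equality constraint\<close>

lemma v_fix_index: "i < K \<Longrightarrow> v_fix K \<alpha> $ i = A i / A K"
  by (simp add: v_fix_def)

text \<open>The three defining cases are all consecutive differences of partial sums divided by
  \<open>A K\<close>, reading the sum before index 0 as zero.\<close>

lemma vs_fix_index:
  assumes "i \<le> K"
  shows "vs_fix K \<alpha> $ i = \<alpha> i / A K"
proof (cases i)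
  case 0
  then show ?thesis using K by (simp add: vs_fix_def v_fix_index partial_sum_def)
next
  case (Suc k)
  with assms have "A (Suc k) / A K = A k / A K + \<alpha> (Suc k) / A K"
    by (simp add: partial_sum_Suc add_divide_distrib)
  with Suc assms A_pos[of K] show ?thesis
    by (cases "i = K") (auto simp: vs_fix_def v_fix_def)
qed

lemma vs_fix_carrier [simp]: "vs_fix K \<alpha> \<in> carrier_vec (K + 1)"
  by (simp add: vs_fix_def)

text \<open>Since the selector of \<open>Star\<close> is zero, \<open>vs $ j\<close> enters
  coordinate \<open>j\<close> alone, with coefficient -1, so the system is already solved for
  \<open>vs\<close>.\<close>

lemma D_equality_iff:
  assumes vs: "vs \<in> carrier_vec (K + 1)"
  shows "D_equality K (v_fix K \<alpha>) vs \<longleftrightarrow> vs = vs_fix K \<alpha>"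
proof -
  let ?V = "vsum (K + 1) (\<lambda>i. v_fix K \<alpha> $ i \<cdot>\<^sub>v (f_vec K (Iter i) - f_vec K (Iter (i + 1)))) {..<K}"
  let ?W = "vsum (K + 1) (\<lambda>i. vs $ i \<cdot>\<^sub>v (f_vec K Star - f_vec K (Iter i))) {..K}"
  have V: "?V \<in> carrier_vec (K + 1)" and W: "?W \<in> carrier_vec (K + 1)"
    by (auto intro!: finsum_vec_closed minus_carrier_vec)
  have entry: "(f_vec K (Iter K) + ?V + ?W) $ j = vs_fix K \<alpha> $ j - vs $ j" if j: "j \<le> K" for j
  proof -
    have "?V $ j = (\<Sum>i<K. v_fix K \<alpha> $ i * ((if j = i then 1 else 0) - (if j = i + 1 then 1 else 0)))"
      using j by (subst index_finsum_vec) (auto intro!: sum.cong minus_carrier_vec)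
    also have "\<dots> = (\<Sum>i<K. if i = j then v_fix K \<alpha> $ i else 0)
        - (\<Sum>i<K. if Suc i = j then v_fix K \<alpha> $ i else 0)"
      unfolding sum_subtractf[symmetric] by (intro sum.cong) auto
    \<comment> \<open>The case \<open>j = 0\<close> is split off because natural subtraction gives
      \<open>j - 1 = 0\<close>, which would wrongly select the first multiplier.\<close>
    also have "(\<Sum>i<K. if Suc i = j then v_fix K \<alpha> $ i else 0)
        = (\<Sum>i<K. if i = j - 1 then if j = 0 then 0 else v_fix K \<alpha> $ i else 0)"
      by (intro sum.cong) auto
    finally have "?V $ j = (if j < K then v_fix K \<alpha> $ j else 0)
        - (if j = 0 then 0 else v_fix K \<alpha> $ (j - 1))"
      using j K by auto
    moreover have "?W $ j = (\<Sum>i\<le>K. - (vs $ i * (if j = i then 1 else 0)))"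
      using j by (subst index_finsum_vec) (auto intro!: sum.cong minus_carrier_vec)
    then have "?W $ j = (\<Sum>i\<le>K. if i = j then - vs $ i else 0)"
      by (simp add: if_distrib[of "\<lambda>t. - (_ * t)"] eq_commute[of j] cong: if_cong)
    ultimately show ?thesis using j K V W by (auto simp: vs_fix_def)
  qed
  have "D_equality K (v_fix K \<alpha>) vs \<longleftrightarrow> (\<forall>j<K + 1. (f_vec K (Iter K) + ?V + ?W) $ j = 0)"
    unfolding D_equality_def using V W by (auto simp: vec_eq_iff)
  also have "\<dots> \<longleftrightarrow> (\<forall>j<K + 1. vs $ j = vs_fix K \<alpha> $ j)"
    using entry by (auto simp: less_Suc_eq_le)
  also have "\<dots> \<longleftrightarrow> vs = vs_fix K \<alpha>"
    using vs vs_fix_carrier by (auto simp: vec_eq_iff)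
  finally show ?thesis .
qed

section \<open>Completing the squares and the semidefiniteness criterion\<close>

text \<open>After telescoping, squares are completed in the weighted gradient sum and in each
  \<open>g (Suc c)\<close>. What remains separates into a multiple of \<open>(z $ 0)^2\<close> and a
  form in the errors alone.\<close>

lemma D_form:
  assumes z: "z \<in> carrier_vec (2 * K + 2)"
    and e: "\<And>i. i < K \<Longrightarrow> z $ (1 + i) = e i"
    and g: "\<And>i. i \<le> K \<Longrightarrow> z $ (1 + K + i) = g i"
  shows "z \<bullet> (D_matrix K L \<alpha> \<tau> (v_fix K \<alpha>) (vs_fix K \<alpha>) u *\<^sub>v z)
    = (\<tau> - L / (4 * A K)) * (z $ 0)\<^sup>2 + ((\<Sum>i\<le>K. \<alpha> i * g i) - L * z $ 0 / 2)\<^sup>2 / (L * A K)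
      + (\<Sum>c<K. d c * (g (Suc c) + (\<Sum>i<K. B i c * e i) / d c)\<^sup>2)
      + ((\<Sum>i<K. u $ i * (e i)\<^sup>2) - (\<Sum>i<K. \<Sum>j<K. H i j * e i * e j))"
proof -
  define x where "x = (\<lambda>k. z $ 0 - 1 / L * (\<Sum>i<k. theta \<alpha> k i * (g i + e i)))"
  define S where "S = (\<Sum>i\<le>K. \<alpha> i * g i)"
  define P where "P = (\<lambda>c. \<Sum>i<K. B i c * e i)"
  have nz: "A K \<noteq> 0" "L \<noteq> 0" using A_pos[of K] L by auto
  have zx: "z \<bullet> x_vec K L \<alpha> (Iter k) = x k" if "k \<le> K" for k
    unfolding scalar_prod_x_vec[OF z that] x_def using that e g by auto
  have zg: "z \<bullet> g_vec K (Iter k) = g k" if "k \<le> K" for k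
    using scalar_prod_g_vec[OF z that] g that by simp
  have ze: "z \<bullet> e_vec K k = e k" if "k < K" for k
    using scalar_prod_e_vec[OF z that] e that by simp
  have V: "v_fix K \<alpha> $ i * (z \<bullet> (A_mat K L \<alpha> (Iter i) (Iter (i + 1)) *\<^sub>v z))
      = A i * ((x i - x (Suc i)) * g (Suc i) + 1 / L / 2 * (g i - g (Suc i))\<^sup>2) / A K"
    if "i < K" for i
    using that by (simp add: quad_A_mat[OF z] zx zg v_fix_index)
  have W: "vs_fix K \<alpha> $ i * (z \<bullet> (A_mat K L \<alpha> Star (Iter i) *\<^sub>v z))
      = \<alpha> i * (- x i * g i + 1 / L / 2 * (g i)\<^sup>2) / A K" if "i \<le> K" for i
    using that by (simp add: quad_A_mat[OF z] zx zg vs_fix_index z)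
  \<comment> \<open>\<open>?M\<close> is \<open>A K\<close> times the contribution of the
    multipliers and the final gradient term, in the shape of \<open>multiplier_sum_identity\<close>
    with \<open>r = 1 / L\<close>.\<close>
  let ?M = "(\<Sum>i<K. A i * ((x i - x (Suc i)) * g (Suc i) + 1 / L / 2 * (g i - g (Suc i))\<^sup>2))
      + (\<Sum>i\<le>K. \<alpha> i * (- x i * g i + 1 / L / 2 * (g i)\<^sup>2)) + A K * (1 / L / 2) * (g K)\<^sup>2"
  have "z \<bullet> (D_matrix K L \<alpha> \<tau> (v_fix K \<alpha>) (vs_fix K \<alpha>) u *\<^sub>v z)
      = ?M / A K + \<tau> * (z $ 0)\<^sup>2 + (\<Sum>i<K. u $ i * (e i)\<^sup>2)"
  proof -
    have "x 0 = z $ 0" by (simp add: x_def)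
    then show ?thesis
      unfolding quad_D_matrix[OF z] using V W zx[of 0] zg[of K] ze nz
      by (simp add: sum_divide_distrib add_divide_distrib)
  qed
  also have "?M = - (z $ 0) * S + 1 / L * S\<^sup>2 + 1 / L * (\<Sum>i\<le>K. (A i - (\<alpha> i)\<^sup>2) * (g i)\<^sup>2)
      + 1 / L * (\<Sum>k<K. g (Suc k) * (2 * \<alpha> (Suc k) * (\<Sum>i\<le>k. \<alpha> i * e i) + A k * e k))"
    unfolding x_def S_def using A_pos
    by (intro multiplier_sum_identity) (metis Suc_leI less_irrefl)
  also have "(\<Sum>i\<le>K. (A i - (\<alpha> i)\<^sup>2) * (g i)\<^sup>2) = L * A K * (\<Sum>c<K. d c * (g (Suc c))\<^sup>2)"
  proof -
    \<comment> \<open>Because \<open>\<alpha> 0 = 1\<close>, the diagonal term of \<open>g 0\<close>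
      disappears, and the sum can be reindexed to start at 1.\<close>
    have "A 0 - (\<alpha> 0)\<^sup>2 = 0" using \<alpha>0 by (simp add: partial_sum_def)
    moreover have "A (Suc c) - (\<alpha> (Suc c))\<^sup>2 = L * A K * d c" for c
      using nz by (simp add: d_def)
    ultimately show ?thesis
      unfolding lessThan_Suc_atMost[symmetric] sum.lessThan_Suc_shift
      by (simp add: sum_distrib_left mult.assoc)
  qed
  also have "(\<Sum>k<K. g (Suc k) * (2 * \<alpha> (Suc k) * (\<Sum>i\<le>k. \<alpha> i * e i) + A k * e k))
      = L * A K * (\<Sum>c<K. 2 * g (Suc c) * P c)"
  proof (subst sum_distrib_left, intro sum.cong refl)
    fix c assume "c \<in> {..<K}"
    then have "2 * \<alpha> (Suc c) * (\<Sum>i\<le>c. \<alpha> i * e i) + A c * e c = L * A K * (2 * P c)"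
      using B_column_sum[of c e] nz by (simp add: P_def)
    then show "g (Suc c) * (2 * \<alpha> (Suc c) * (\<Sum>i\<le>c. \<alpha> i * e i) + A c * e c)
        = L * A K * (2 * g (Suc c) * P c)" by simp
  qed
  finally have Q: "z \<bullet> (D_matrix K L \<alpha> \<tau> (v_fix K \<alpha>) (vs_fix K \<alpha>) u *\<^sub>v z)
    = (- z $ 0 * S + 1 / L * S\<^sup>2 + 1 / L * (L * A K * (\<Sum>c<K. d c * (g (Suc c))\<^sup>2))
      + 1 / L * (L * A K * (\<Sum>c<K. 2 * g (Suc c) * P c))) / A K
      + \<tau> * (z $ 0)\<^sup>2 + (\<Sum>i<K. u $ i * (e i)\<^sup>2)" .
  have sq: "(\<Sum>c<K. d c * (g (Suc c) + P c / d c)\<^sup>2)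
      = (\<Sum>c<K. d c * (g (Suc c))\<^sup>2 + 2 * g (Suc c) * P c + (P c)\<^sup>2 / d c)"
  proof (intro sum.cong refl)
    fix c assume "c \<in> {..<K}"
    then have "d c \<noteq> 0" using d_pos[of c] by simp
    then show "d c * (g (Suc c) + P c / d c)\<^sup>2
        = d c * (g (Suc c))\<^sup>2 + 2 * g (Suc c) * P c + (P c)\<^sup>2 / d c"
      by (simp add: power2_eq_square field_simps)
  qed
  have P: "(\<Sum>i<K. B i c * e i) = P c" for c by (simp add: P_def)
  \<comment> \<open>Completing the square in \<open>S\<close> uses up \<open>L / (4 * A K)\<close>
    of the coefficient of \<open>(z $ 0)^2\<close>; \<open>Z\<close> is the remainder from the
    gradient squares, to be identified with the form of \<open>H\<close>.\<close>
  have complete_square: "(- z $ 0 * S + 1 / L * S\<^sup>2 + 1 / L * (L * A K * X) + 1 / L * (L * A K * Y)) / A K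
        + \<tau> * (z $ 0)\<^sup>2 + U
      = (\<tau> - L / (4 * A K)) * (z $ 0)\<^sup>2 + (S - L * z $ 0 / 2)\<^sup>2 / (L * A K) + (X + Y + Z) + (U - Z)"
    for X Y Z U :: real
    using nz by (simp add: field_simps power2_eq_square)
  show ?thesis
    unfolding Q H_form S_def[symmetric] P sq sum.distrib by (rule complete_square)
qed

text \<open>In \<open>D_form\<close> the squares have positive weights, which gives sufficiency. For
  necessity the gradients can be chosen to cancel those squares for any prescribed
  \<open>z $ 0\<close> and errors.\<close>

lemma psd_iff:
  "psd (2 * K + 2) (D_matrix K L \<alpha> \<tau> (v_fix K \<alpha>) (vs_fix K \<alpha>) u) \<longleftrightarrow>
    L / (4 * A K) \<le> \<tau>
    \<and> (\<forall>e. (\<Sum>i<K. \<Sum>j<K. H i j * e i * e j) \<le> (\<Sum>i<K. u $ i * (e i)\<^sup>2))"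
  (is "psd _ ?M \<longleftrightarrow> ?\<tau> \<and> ?u")
proof
  assume psd: "psd (2 * K + 2) ?M"
  \<comment> \<open>The test vector makes every completed square vanish.\<close>
  have main: "0 \<le> (\<tau> - L / (4 * A K)) * t\<^sup>2
      + ((\<Sum>i<K. u $ i * (e i)\<^sup>2) - (\<Sum>i<K. \<Sum>j<K. H i j * e i * e j))" for t e
  proof -
    define P where "P = (\<lambda>c. (\<Sum>i<K. B i c * e i) / d c)"
    \<comment> \<open>The later gradients are dictated by their own squares; \<open>g 0\<close>
      occurs only in the weighted sum, with coefficient \<open>\<alpha> 0 = 1\<close>, and so can
      bring that sum to \<open>L * t / 2\<close>.\<close>
    define g where "g = (\<lambda>i. case i of 0 \<Rightarrow> L * t / 2 + (\<Sum>c<K. \<alpha> (Suc c) * P c) | Suc c \<Rightarrow> - P c)"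
    define z where "z = vec (2 * K + 2) (\<lambda>i. if i = 0 then t else if i \<le> K then e (i - 1) else g (i - (1 + K)))"
    have z: "z \<in> carrier_vec (2 * K + 2)" "z $ 0 = t"
      "\<And>i. i < K \<Longrightarrow> z $ (1 + i) = e i" "\<And>i. i \<le> K \<Longrightarrow> z $ (1 + K + i) = g i"
      by (auto simp: z_def)
    have S: "(\<Sum>i\<le>K. \<alpha> i * g i) = L * t / 2"
      using \<alpha>0 unfolding lessThan_Suc_atMost[symmetric] sum.lessThan_Suc_shift
      by (simp add: g_def sum_negf)
    have "g (Suc c) + (\<Sum>i<K. B i c * e i) / d c = 0" for c
      by (simp add: g_def P_def)
    moreover have "0 \<le> z \<bullet> (?M *\<^sub>v z)" using psd z by (auto simp: psd_def)
    ultimately show ?thesis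
      unfolding D_form[OF z(1,3,4), of \<tau> u, simplified] z(2) S by simp
  qed
  \<comment> \<open>Zero errors with \<open>t = 1\<close> isolate the bound on
    \<open>\<tau>\<close>; \<open>t = 0\<close> isolates the bound on \<open>u\<close>.\<close>
  show "?\<tau> \<and> ?u"
    using main[of 1 "\<lambda>_. 0"] main[of 0] by simp
next
  assume *: "?\<tau> \<and> ?u"
  have "0 \<le> z \<bullet> (?M *\<^sub>v z)" if z: "z \<in> carrier_vec (2 * K + 2)" for z
  proof -
    have "0 \<le> (\<Sum>c<K. d c * (z $ (1 + K + Suc c) + (\<Sum>i<K. B i c * z $ (1 + i)) / d c)\<^sup>2)"
      using d_pos by (intro sum_nonneg) (simp add: less_imp_le)
    then show ?thesis
      using * L A_pos[of K]
      by (subst D_form[OF z refl refl]) (intro add_nonneg_nonneg; simp)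
  qed
  then show "psd (2 * K + 2) ?M" by (simp add: psd_def symmetric_D_matrix)
qed

text \<open>Positivity of \<open>A\<close> and \<open>L\<close> and nonnegativity of
  \<open>\<alpha>\<close> supply the signs of the multipliers and of \<open>\<tau>\<close>; the
  equality constraint fixes \<open>vs\<close>, and \<open>psd_iff\<close> settles the matrix
  constraint.\<close>

lemma restricted_feasible_iff:
  "restricted_feasible K L \<alpha> (\<tau>, vs, u) \<longleftrightarrow>
    vs = vs_fix K \<alpha> \<and> u \<in> carrier_vec K \<and> (\<forall>i<K. 0 \<le> u $ i) \<and> L / (4 * A K) \<le> \<tau>
    \<and> (\<forall>e. (\<Sum>i<K. \<Sum>j<K. H i j * e i * e j) \<le> (\<Sum>i<K. u $ i * (e i)\<^sup>2))"
proof -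
  have "0 \<le> v_fix K \<alpha> $ i" if "i < K" for i
    using that A_pos[of i] A_pos[of K] by (simp add: v_fix_index)
  moreover have "0 \<le> vs_fix K \<alpha> $ i" if "i \<le> K" for i
    using that \<alpha>_nonneg'[of i] A_pos[of K] by (simp add: vs_fix_index)
  moreover have "0 \<le> \<tau>" if "L / (4 * A K) \<le> \<tau>"
    by (rule order_trans[OF _ that]) (use L A_pos[of K] in simp)
  moreover have "v_fix K \<alpha> \<in> carrier_vec K" by (simp add: v_fix_def)
  ultimately show ?thesis
    using vs_fix_carrier D_equality_iff by (auto simp: D_feasible_def psd_iff)
qed

section \<open>Optimal value and uniqueness of the minimizer\<close>

context
  fixes b :: "real vec" and R :: real
  assumes R: "0 < R" and b: "b \<in> carrier_vec K" and b_pos: "\<And>i. i < K \<Longrightarrow> 0 < b $ i"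
begin

lemma H_mult_b: "i < K \<Longrightarrow> (H_mat K L \<alpha> *\<^sub>v b) $ i = (\<Sum>j<K. H i j * b $ j)"
  using b carrier_matD[OF H_carrier] by (simp add: scalar_prod_def atLeast0LessThan)

lemma b_H_b: "b \<bullet> (H_mat K L \<alpha> *\<^sub>v b) = (\<Sum>i<K. \<Sum>j<K. H i j * b $ i * b $ j)"
  by (subst quad_eq_sum[OF H_carrier b]) (simp add: mult.commute)

lemma u_hat_index: "i < K \<Longrightarrow> u_hat K L \<alpha> b $ i = (\<Sum>j<K. H i j * b $ j) / b $ i"
  by (simp add: u_hat_def H_mult_b)

text \<open>\<open>H\<close> is symmetric and entrywise nonnegative, so
  \<open>nonneg_form_le_diagonal\<close> with weights \<open>b\<close> yields the domination by
  \<open>u_hat\<close>.\<close>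

lemma optimum_feasible:
  "restricted_feasible K L \<alpha> (L / (4 * A K), vs_fix K \<alpha>, u_hat K L \<alpha> b)"
proof -
  have "0 \<le> u_hat K L \<alpha> b $ i" if "i < K" for i
    using that b_pos H_nonneg
    by (auto simp: u_hat_index less_imp_le intro!: divide_nonneg_nonneg sum_nonneg)
  moreover have "(\<Sum>i<K. \<Sum>j<K. H i j * e i * e j) \<le> (\<Sum>i<K. u_hat K L \<alpha> b $ i * (e i)\<^sup>2)" for e
    using nonneg_form_le_diagonal[of K "\<lambda>i j. H i j" "\<lambda>i. b $ i" e] H_nonneg H_sym b_pos
    by (simp add: u_hat_index)
  moreover have "u_hat K L \<alpha> b \<in> carrier_vec K" by (simp add: u_hat_def)
  ultimately show ?thesis unfolding restricted_feasible_iff by simp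
qed

lemma optimum_value:
  "restricted_objective K R b (L / (4 * A K), vs_fix K \<alpha>, u_hat K L \<alpha> b)
    = L * R\<^sup>2 / (4 * A K) + b \<bullet> (H_mat K L \<alpha> *\<^sub>v b)"
proof -
  have "(\<Sum>i<K. u_hat K L \<alpha> b $ i * (b $ i)\<^sup>2) = (\<Sum>i<K. \<Sum>j<K. H i j * b $ i * b $ j)"
  proof (intro sum.cong refl)
    fix i assume "i \<in> {..<K}"
    then show "u_hat K L \<alpha> b $ i * (b $ i)\<^sup>2 = (\<Sum>j<K. H i j * b $ i * b $ j)"
      using b_pos[of i] by (simp add: u_hat_index power2_eq_square sum_distrib_left sum_divide_distrib algebra_simps)
  qed
  then show ?thesis by (simp add: D_objective_def b_H_b)
qed

text \<open>Evaluating the domination constraint at \<open>b\<close> bounds the error part of the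
  objective, and the bound on \<open>\<tau>\<close> handles the rest. In the equality case both
  estimates are tight: \<open>R > 0\<close> then fixes \<open>\<tau>\<close>, and contact of the
  forms at \<open>b\<close> fixes \<open>u\<close>.\<close>

lemma objective_lower_bound:
  assumes "restricted_feasible K L \<alpha> p"
  shows "L * R\<^sup>2 / (4 * A K) + b \<bullet> (H_mat K L \<alpha> *\<^sub>v b) \<le> restricted_objective K R b p"
    and "restricted_objective K R b p \<le> L * R\<^sup>2 / (4 * A K) + b \<bullet> (H_mat K L \<alpha> *\<^sub>v b)
      \<Longrightarrow> p = (L / (4 * A K), vs_fix K \<alpha>, u_hat K L \<alpha> b)"
proof -
  obtain \<tau> vs u where p: "p = (\<tau>, vs, u)" by (cases p) auto
  from assms have \<tau>: "L / (4 * A K) \<le> \<tau>" and vs: "vs = vs_fix K \<alpha>" and u: "u \<in> carrier_vec K"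
    and dom: "\<And>e. (\<Sum>i<K. \<Sum>j<K. H i j * e i * e j) \<le> (\<Sum>i<K. u $ i * (e i)\<^sup>2)"
    unfolding p restricted_feasible_iff by auto
  have obj: "restricted_objective K R b p = \<tau> * R\<^sup>2 + (\<Sum>i<K. u $ i * (b $ i)\<^sup>2)"
    by (simp add: p D_objective_def)
  have 1: "L * R\<^sup>2 / (4 * A K) \<le> \<tau> * R\<^sup>2"
    using mult_right_mono[OF \<tau>, of "R\<^sup>2"] by simp
  have 2: "b \<bullet> (H_mat K L \<alpha> *\<^sub>v b) \<le> (\<Sum>i<K. u $ i * (b $ i)\<^sup>2)"
    unfolding b_H_b by (rule dom)
  show "L * R\<^sup>2 / (4 * A K) + b \<bullet> (H_mat K L \<alpha> *\<^sub>v b) \<le> restricted_objective K R b p"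
    using 1 2 obj by simp
  assume le: "restricted_objective K R b p \<le> L * R\<^sup>2 / (4 * A K) + b \<bullet> (H_mat K L \<alpha> *\<^sub>v b)"
  have "\<tau> * R\<^sup>2 = L / (4 * A K) * R\<^sup>2" using le 1 2 obj by simp
  then have "\<tau> = L / (4 * A K)" using R by (simp only: mult_cancel_right) simp
  moreover have "(\<Sum>i<K. \<Sum>j<K. H i j * b $ i * b $ j) = (\<Sum>i<K. u $ i * (b $ i)\<^sup>2)"
    using le 1 2 obj b_H_b by simp
  then have "u $ k * b $ k = (\<Sum>j<K. H k j * b $ j)" if "k < K" for k
    using diagonal_form_contact[of K "\<lambda>i j. H i j" "\<lambda>i. u $ i" "\<lambda>i. b $ i" k] H_sym dom that
    by blast
  then have "u $ k = u_hat K L \<alpha> b $ k" if "k < K" for k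
    using that b_pos[of k] by (simp add: u_hat_index eq_divide_eq)
  then have "u = u_hat K L \<alpha> b"
    using u by (intro eq_vecI) (auto simp: u_hat_def)
  ultimately show "p = (L / (4 * A K), vs_fix K \<alpha>, u_hat K L \<alpha> b)" by (simp add: p vs)
qed

end

end

theorem lemma8:
  fixes K :: nat and L R :: real and \<alpha> :: "nat \<Rightarrow> real" and b :: "real vec"
  assumes "1 \<le> K" and "0 < L" and "0 < R"
    and "\<alpha> 0 = 1" and "\<And>k. 1 \<le> k \<Longrightarrow> k \<le> K \<Longrightarrow> 0 \<le> \<alpha> k"
    and "\<And>k. 1 \<le> k \<Longrightarrow> k \<le> K \<Longrightarrow> 0 < partial_sum \<alpha> k - (\<alpha> k)\<^sup>2"
    and "b \<in> carrier_vec K" and "\<And>i. i < K \<Longrightarrow> 0 < b $ i"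
  shows "(\<forall>vs \<in> carrier_vec (K + 1). D_equality K (v_fix K \<alpha>) vs \<longleftrightarrow> vs = vs_fix K \<alpha>)
    \<and> {p. is_arg_min (restricted_objective K R b) (restricted_feasible K L \<alpha>) p}
        = {(L / (4 * partial_sum \<alpha> K), vs_fix K \<alpha>, u_hat K L \<alpha> b)}
    \<and> D_feasible K L \<alpha> (L / (4 * partial_sum \<alpha> K)) (v_fix K \<alpha>) (vs_fix K \<alpha>) (u_hat K L \<alpha> b)
    \<and> (INF p \<in> {p. restricted_feasible K L \<alpha> p}. restricted_objective K R b p)
        = L * R\<^sup>2 / (4 * partial_sum \<alpha> K) + b \<bullet> (H_mat K L \<alpha> *\<^sub>v b)"
proof -
  interpret restricted_dual K L \<alpha> using assms by unfold_locales auto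
  note b = \<open>0 < R\<close> \<open>b \<in> carrier_vec K\<close> \<open>\<And>i. i < K \<Longrightarrow> 0 < b $ i\<close>
  let ?p = "(L / (4 * A K), vs_fix K \<alpha>, u_hat K L \<alpha> b)"
  let ?F = "{p. restricted_feasible K L \<alpha> p}"
  note feasible = optimum_feasible[OF b] and opt = optimum_value[OF b]
  note bound = objective_lower_bound[OF b]
  have "is_arg_min (restricted_objective K R b) (restricted_feasible K L \<alpha>) p \<longleftrightarrow> p = ?p" for p
  proof
    assume "is_arg_min (restricted_objective K R b) (restricted_feasible K L \<alpha>) p"
    then have "restricted_feasible K L \<alpha> p"
      and "restricted_objective K R b p \<le> restricted_objective K R b ?p"
      using feasible unfolding is_arg_min_linorder by blast+
    \<comment> \<open>A minimizer does at least as well as \<open>?p\<close>, which attains the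
      lower bound, so the equality case applies.\<close>
    then show "p = ?p" using bound(2) opt by metis
  next
    assume "p = ?p"
    then show "is_arg_min (restricted_objective K R b) (restricted_feasible K L \<alpha>) p"
      using feasible opt bound(1) unfolding is_arg_min_linorder by metis
  qed
  then have "{p. is_arg_min (restricted_objective K R b) (restricted_feasible K L \<alpha>) p} = {?p}"
    by blast
  moreover have "(INF p \<in> ?F. restricted_objective K R b p) = restricted_objective K R b ?p"
    using feasible opt bound(1) by (intro cInf_eq_minimum[OF imageI]) auto
  moreover have "D_feasible K L \<alpha> (L / (4 * A K)) (v_fix K \<alpha>) (vs_fix K \<alpha>) (u_hat K L \<alpha> b)"
    using feasible by simp
  ultimately show ?thesis using D_equality_iff opt by simp
qed

end
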